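(* Let $\mathcal H$ be a real Hilbert space and let $\Phi:\mathcal H\to\mathbb R$ be a continuously differentiable convex even function (that is, $\Phi(-x)=\Phi(x)$ for every $x\in\mathcal H$). Let $t_0>0$, $\alpha>3$, and let $x:[t_0,+\infty[\to\mathcal H$ be a solution of $$\ddot x(t)+\frac{\alpha}{t}\dot x(t)+\nabla\Phi(x(t))=0 .$$ Then $x(t)$ converges strongly, as $t\to+\infty$, to a point in $\operatorname{argmin}\Phi$.
   Context: A solution on $[t_0,+\infty[$ is a twice continuously differentiable function $x:[t_0,+\infty[\to\mathcal H$ satisfying the equation for all $t\ge t_0$. $\operatorname{argmin}\Phi$ denotes the set of global minimizers of $\Phi$. Strong convergence means convergence in norm. *)

theory Defs
  imports "HOL-Analysis.Analysis"
begin

definition argmin :: "('a \<Rightarrow> real) \<Rightarrow> 'a set"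
  where "argmin \<Phi> = {z. is_arg_min \<Phi> (\<lambda>_. True) z}"

(* A twice continuously differentiable solution on [t0, +infinity[ of
     x''(t) + (alpha / t) x'(t) + G (x(t)) = 0.
   Derivatives are taken within [t0, +infinity[, hence one-sided at t0; the values of
   the total function x to the left of t0 play no role. *)
definition solution_on ::
    "real \<Rightarrow> ('a::real_normed_vector \<Rightarrow> 'a) \<Rightarrow> real \<Rightarrow> (real \<Rightarrow> 'a) \<Rightarrow> bool"
  where "solution_on \<alpha> G t0 x \<longleftrightarrow>
    (\<exists>x' x''.
       (\<forall>t\<ge>t0. (x has_vector_derivative x' t) (at t within {t0..})) \<and>
       (\<forall>t\<ge>t0. (x' has_vector_derivative x'' t) (at t within {t0..})) \<and>
       continuous_on {t0..} x'' \<and>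
       (\<forall>t\<ge>t0. x'' t + (\<alpha> / t) *\<^sub>R x' t + G (x t) = 0))"

end

theory Submission
  imports Defs
begin

text \<open>
  As \<open>\<Phi>\<close> is convex and even, \<open>0\<close> is a minimizer. Put \<open>W = \<Phi> \<circ> x - \<Phi> 0\<close>. For \<open>\<alpha> > 3\<close> the
  Lyapunov function
  \<open>E t = t\<^sup>2 * W t + \<parallel>\<lambda> x t + t x' t\<parallel>\<^sup>2 / 2 + \<lambda> * (\<alpha> - 1 - \<lambda>) / 2 * \<parallel>x t\<parallel>\<^sup>2\<close>,
  with \<open>\<lambda>\<close> midway between \<open>2\<close> and \<open>\<alpha> - 1\<close>, satisfies \<open>E' \<le> - c * t * (W + \<parallel>x'\<parallel>\<^sup>2)\<close> for some
  \<open>c > 0\<close>. This gives boundedness of \<open>x\<close> and \<open>t\<^sup>2 * (W + \<parallel>x'\<parallel>\<^sup>2 / 2) \<longlongrightarrow> 0\<close>.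

  For a real function \<open>g\<close> with \<open>g'' + \<alpha> / t * g' \<le> K * \<parallel>x'\<parallel>\<^sup>2\<close> one has
  \<open>(t * g' + (\<alpha> - 1) * g)' \<le> K * t * \<parallel>x'\<parallel>\<^sup>2\<close>, so \<open>t * g' + (\<alpha> - 1) * g + K / c * E\<close> decreases.
  Taking \<open>g = \<parallel>x\<parallel>\<^sup>2 / 2\<close> shows that \<open>\<parallel>x\<parallel>\<close> converges. Taking, for fixed \<open>s\<close>,
  \<open>g t = \<parallel>x t\<parallel>\<^sup>2 - \<parallel>x s\<parallel>\<^sup>2 - \<parallel>x t - x s\<parallel>\<^sup>2 / 2\<close> on \<open>t \<le> s\<close>, where evenness turns the convexity
  inequality at \<open>- x s\<close> into the required bound, gives \<open>- g t \<longlongrightarrow> 0\<close> from above, uniformly in \<open>s\<close>: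
  the trajectory is Cauchy.
\<close>

section \<open>Convexity, monotone limits and derivatives of inner products\<close>

lemma convex_gderiv_le:
  fixes f :: "'a::real_inner \<Rightarrow> real"
  assumes "convex_on UNIV f" and "GDERIV f u :> D"
  shows "f u + inner D (v - u) \<le> f v"
proof -
  \<comment> \<open>Restriction to the line through \<open>u\<close> and \<open>v\<close> reduces
    the claim to the tangent inequality in one variable, between the parameters 0 and 1.\<close>
  define g where "g = (\<lambda>s. f (u + s *\<^sub>R (v - u)))"
  have cv: "convex_on UNIV g"
  proof (rule convex_onI)
    fix r a b :: real assume r: "0 < r" "r < 1"
    have "u + ((1 - r) *\<^sub>R a + r *\<^sub>R b) *\<^sub>R (v - u)
        = (1 - r) *\<^sub>R (u + a *\<^sub>R (v - u)) + r *\<^sub>R (u + b *\<^sub>R (v - u))"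
      by (simp add: algebra_simps)
    then show "g ((1 - r) *\<^sub>R a + r *\<^sub>R b) \<le> (1 - r) * g a + r * g b"
      using convex_onD[OF assms(1), of r "u + a *\<^sub>R (v - u)" "u + b *\<^sub>R (v - u)"] r
      by (simp add: g_def)
  qed simp
  \<comment> \<open>The base point is written as the value of the affine path at 0, the form in
    which the chain rule expects it.\<close>
  have fd: "(f has_derivative (\<lambda>h. inner h D)) (at (u + 0 *\<^sub>R (v - u)))"
    using assms(2) by (simp add: gderiv_def)
  have "((\<lambda>s. u + s *\<^sub>R (v - u)) has_derivative (\<lambda>s. s *\<^sub>R (v - u))) (at 0)"
    by (auto intro!: derivative_eq_intros)
  from has_derivative_compose[OF this fd]
  have "(g has_field_derivative inner D (v - u)) (at 0 within UNIV)"
    by (simp add: g_def has_field_derivative_def inner_commute mult_commute_abs)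
  from convex_on_imp_above_tangent[OF cv _ _ _ this, of 1]
  show ?thesis by (simp add: g_def)
qed

lemma tendsto_at_top_antimono_bdd_below:
  fixes f :: "real \<Rightarrow> real"
  assumes anti: "\<And>a b. \<lbrakk>T < a; a \<le> b\<rbrakk> \<Longrightarrow> f b \<le> f a"
    and bdd: "\<And>t. T < t \<Longrightarrow> B \<le> f t"
  obtains L where "(f \<longlongrightarrow> L) at_top" and "\<And>t. T < t \<Longrightarrow> L \<le> f t"
proof
  define L where "L = Inf (f ` {T<..})"
  have bb: "bdd_below (f ` {T<..})" using bdd by (auto intro!: bdd_belowI[of _ B])
  show lower: "L \<le> f t" if "T < t" for t
    unfolding L_def using bb that by (auto intro!: cInf_lower)
  show "(f \<longlongrightarrow> L) at_top"
  proof (rule order_tendstoI)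
    fix y assume "y < L"
    then show "eventually (\<lambda>t. y < f t) at_top"
      using lower
      by (intro eventually_mono[OF eventually_gt_at_top[of T]]) (metis less_le_trans)
  next
    fix y assume "L < y"
    then obtain a where "T < a" "f a < y"
      using cInf_lessD[of "f ` {T<..}" y] by (auto simp: L_def)
    then show "eventually (\<lambda>t. f t < y) at_top"
      using anti
      by (intro eventually_mono[OF eventually_ge_at_top[of a]]) (metis le_less_trans)
  qed
qed

lemma has_real_derivative_inner:
  fixes x y :: "real \<Rightarrow> 'a::real_inner"
  assumes "(x has_vector_derivative v) (at t)" and "(y has_vector_derivative w) (at t)"
  shows "((\<lambda>t. inner (x t) (y t)) has_real_derivative inner v (y t) + inner (x t) w) (at t)"
proof -
  have "(\<lambda>h. inner (x t) (h *\<^sub>R w) + inner (h *\<^sub>R v) (y t))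
      = (*) (inner v (y t) + inner (x t) w)"
    by (simp add: fun_eq_iff algebra_simps)
  with has_derivative_inner[OF assms[unfolded has_vector_derivative_def]] show ?thesis
    by (simp only: has_field_derivative_def)
qed

lemma has_real_derivative_norm_power2:
  fixes x :: "real \<Rightarrow> 'a::real_inner"
  assumes "(x has_vector_derivative v) (at t)"
  shows "((\<lambda>t. (norm (x t))\<^sup>2) has_real_derivative 2 * inner (x t) v) (at t)"
  using has_real_derivative_inner[OF assms assms]
  by (simp add: power2_norm_eq_inner inner_commute)

section \<open>The flow, its Lyapunov function and the dissipation estimate\<close>

locale damped_even_flow =
  fixes \<Phi> :: "'a::{real_inner, complete_space} \<Rightarrow> real"
    and grad\<Phi> :: "'a \<Rightarrow> 'a"
    and \<alpha> t0 :: real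
    and x x' x'' :: "real \<Rightarrow> 'a"
  assumes grad: "\<And>u. GDERIV \<Phi> u :> grad\<Phi> u"
    and conv: "convex_on UNIV \<Phi>"
    and even: "\<And>u. \<Phi> (- u) = \<Phi> u"
    and t0: "t0 > 0"
    and alpha: "\<alpha> > 3"
    and x_deriv: "\<And>t. t0 < t \<Longrightarrow> (x has_vector_derivative x' t) (at t)"
    and x'_deriv: "\<And>t. t0 < t \<Longrightarrow> (x' has_vector_derivative x'' t) (at t)"
    and ode: "\<And>t. t0 < t \<Longrightarrow> x'' t + (\<alpha> / t) *\<^sub>R x' t + grad\<Phi> (x t) = 0"
begin

definition gap :: "real \<Rightarrow> real"
  where "gap t = \<Phi> (x t) - \<Phi> 0"

text \<open>The common value of \<open>lam - 2\<close> and \<open>\<alpha> - 1 - lam\<close>. The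
  midpoint choice of \<open>lam\<close> gives \<open>gap\<close> and the squared velocity the same
  dissipation rate; \<open>\<alpha> > 3\<close> makes it positive.\<close>

definition c :: real
  where "c = (\<alpha> - 3) / 2"

definition lam :: real
  where "lam = (\<alpha> + 1) / 2"

definition lyap :: "real \<Rightarrow> real"
  where "lyap t = t\<^sup>2 * gap t + (norm (lam *\<^sub>R x t + t *\<^sub>R x' t))\<^sup>2 / 2 + lam * c / 2 * (norm (x t))\<^sup>2"

definition lyap' :: "real \<Rightarrow> real"
  where "lyap' t = 2 * t * gap t - lam * t * inner (x t) (grad\<Phi> (x t)) - c * t * (norm (x' t))\<^sup>2"

definition energy :: "real \<Rightarrow> real"
  where "energy t = (norm (x' t))\<^sup>2 / 2 + gap t"

lemma c_pos: "c > 0" and lam_gt_2: "lam > 2"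
  using alpha by (auto simp: c_def lam_def)

text \<open>The origin is the midpoint of \<open>u\<close> and \<open>- u\<close>, at which
  \<open>\<Phi>\<close> takes equal values.\<close>

lemma zero_min: "\<Phi> 0 \<le> \<Phi> u"
  using convex_onD[OF conv, of "1/2" u "- u"] even[of u] by simp

lemma gap_nonneg: "gap t \<ge> 0"
  using zero_min by (simp add: gap_def)

text \<open>Tangent inequality at \<open>x t\<close>, evaluated at the minimizer 0.\<close>

lemma gap_le_inner: "gap t \<le> inner (x t) (grad\<Phi> (x t))"
  using convex_gderiv_le[OF conv grad, of "x t" 0] by (simp add: gap_def inner_commute)

lemma energy_nonneg: "energy t \<ge> 0"
  using gap_nonneg by (simp add: energy_def)

lemma scaled_ode: "t0 < t \<Longrightarrow> t *\<^sub>R x'' t = - (\<alpha> *\<^sub>R x' t) - t *\<^sub>R grad\<Phi> (x t)"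
proof -
  assume t: "t0 < t"
  from ode[OF t] have "x'' t = - ((\<alpha> / t) *\<^sub>R x' t) - grad\<Phi> (x t)"
    by (simp add: eq_neg_iff_add_eq_0 algebra_simps)
  then show ?thesis using t t0 by (simp add: scaleR_diff_right)
qed

lemma gap_deriv:
  assumes "t0 < t"
  shows "(gap has_real_derivative inner (x' t) (grad\<Phi> (x t))) (at t)"
proof -
  have "((\<lambda>t. \<Phi> (x t)) has_derivative (\<lambda>h. inner (h *\<^sub>R x' t) (grad\<Phi> (x t)))) (at t)"
    using has_derivative_compose[OF x_deriv[OF assms, unfolded has_vector_derivative_def]
        grad[of "x t", unfolded gderiv_def]] .
  then have "((\<lambda>t. \<Phi> (x t)) has_real_derivative inner (x' t) (grad\<Phi> (x t))) (at t)"
    by (simp add: has_field_derivative_def mult_commute_abs)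
  from DERIV_diff[OF this DERIV_const, of "\<Phi> 0"] show ?thesis
    unfolding gap_def[abs_def] by simp
qed

text \<open>Once the equation has eliminated \<open>x''\<close>, the products of \<open>x\<close>
  with \<open>x'\<close> and of \<open>x'\<close> with the gradient cancel; the last term of
  \<open>lyap\<close> is weighted for this.\<close>

lemma lyap_deriv:
  assumes t: "t0 < t"
  shows "(lyap has_real_derivative lyap' t) (at t)"
proof -
  let ?g = "grad\<Phi> (x t)"
  have w: "((\<lambda>t. lam *\<^sub>R x t + t *\<^sub>R x' t) has_vector_derivative
        lam *\<^sub>R x' t + (t *\<^sub>R x'' t + 1 *\<^sub>R x' t)) (at t)"
  proof (rule has_vector_derivative_add)
    show "((\<lambda>t. lam *\<^sub>R x t) has_vector_derivative lam *\<^sub>R x' t) (at t)"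
      using has_vector_derivative_scaleR[OF DERIV_const x_deriv[OF t]] by simp
    show "((\<lambda>t. t *\<^sub>R x' t) has_vector_derivative t *\<^sub>R x'' t + 1 *\<^sub>R x' t) (at t)"
      by (rule has_vector_derivative_scaleR[OF DERIV_ident x'_deriv[OF t]])
  qed
  have "(lyap has_real_derivative
      2 * t * gap t + t\<^sup>2 * inner (x' t) ?g
      + inner (lam *\<^sub>R x t + t *\<^sub>R x' t) (lam *\<^sub>R x' t + (t *\<^sub>R x'' t + 1 *\<^sub>R x' t))
      + lam * c * inner (x t) (x' t)) (at t)"
    unfolding lyap_def[abs_def]
    by (rule derivative_eq_intros gap_deriv[OF t] has_real_derivative_norm_power2[OF w]
          has_real_derivative_norm_power2[OF x_deriv[OF t]] refl | simp)+
  moreover have "lam *\<^sub>R x' t + (t *\<^sub>R x'' t + 1 *\<^sub>R x' t) = (- c) *\<^sub>R x' t - t *\<^sub>R ?g"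
  proof -
    have "lam *\<^sub>R x' t + (t *\<^sub>R x'' t + 1 *\<^sub>R x' t) = (lam + 1 - \<alpha>) *\<^sub>R x' t - t *\<^sub>R ?g"
      unfolding scaled_ode[OF t] by (simp add: algebra_simps)
    also have "lam + 1 - \<alpha> = - c" by (simp add: lam_def c_def field_simps)
    finally show ?thesis .
  qed
  ultimately have "(lyap has_real_derivative
      2 * t * gap t + t\<^sup>2 * inner (x' t) ?g
      + inner (lam *\<^sub>R x t + t *\<^sub>R x' t) ((- c) *\<^sub>R x' t - t *\<^sub>R ?g)
      + lam * c * inner (x t) (x' t)) (at t)"
    by simp
  moreover have "2 * t * gap t + t\<^sup>2 * inner (x' t) ?g
      + inner (lam *\<^sub>R x t + t *\<^sub>R x' t) ((- c) *\<^sub>R x' t - t *\<^sub>R ?g)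
      + lam * c * inner (x t) (x' t) = lyap' t"
    by (simp add: lyap'_def inner_add_left inner_diff_right power2_norm_eq_inner)
       (simp add: algebra_simps power2_eq_square)
  ultimately show ?thesis by simp
qed

text \<open>In \<open>lam = 2 + c\<close> the summand 2 pays for the growth of the factor
  \<open>t\<^sup>2\<close>, and \<open>c\<close> remains as dissipation of
  \<open>gap\<close>.\<close>

lemma lyap'_le:
  assumes "t0 < t"
  shows "lyap' t \<le> - c * t * (gap t + (norm (x' t))\<^sup>2)"
proof -
  have "lam * t * gap t \<le> lam * t * inner (x t) (grad\<Phi> (x t))"
    using assms t0 lam_gt_2 by (intro mult_left_mono gap_le_inner) auto
  moreover have "lam = 2 + c" by (simp add: lam_def c_def field_simps)
  ultimately show ?thesis by (simp add: lyap'_def algebra_simps)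
qed

lemma nonincreasing_of_deriv:
  assumes "\<And>t. \<lbrakk>t0 < t; a \<le> t; t \<le> b\<rbrakk> \<Longrightarrow> (f has_real_derivative f' t) (at t)"
    and "\<And>t. \<lbrakk>t0 < t; a \<le> t; t \<le> b\<rbrakk> \<Longrightarrow> f' t \<le> 0"
    and "t0 < a" "a \<le> b"
  shows "f b \<le> f a"
proof (rule DERIV_nonpos_imp_nonincreasing[where f = f and a = a and b = b])
  fix t assume "a \<le> t" "t \<le> b"
  with assms show "\<exists>y. (f has_real_derivative y) (at t) \<and> y \<le> 0"
    by (meson less_le_trans)
qed fact

section \<open>Decrease of the Lyapunov function and boundedness of the trajectory\<close>

lemma lyap_antimono:
  assumes "t0 < a" "a \<le> b"
  shows "lyap b \<le> lyap a"
proof (rule nonincreasing_of_deriv[OF lyap_deriv _ assms])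
  fix t assume t: "t0 < t"
  have "0 \<le> c * t * (gap t + (norm (x' t))\<^sup>2)"
    using t t0 c_pos gap_nonneg[of t] by simp
  with lyap'_le[OF t] show "lyap' t \<le> 0" by simp
qed

lemma lyap_ge: "lyap t \<ge> lam * c / 2 * (norm (x t))\<^sup>2"
  using gap_nonneg[of t] by (simp add: lyap_def)

lemma lyap_nonneg: "lyap t \<ge> 0"
  using c_pos lam_gt_2 by (intro order_trans[OF _ lyap_ge]) simp

lemma lyap_tendsto: obtains L where "(lyap \<longlongrightarrow> L) at_top"
  by (rule tendsto_at_top_antimono_bdd_below[of t0 lyap 0]) (use lyap_antimono lyap_nonneg in auto)

lemma x_bounded: obtains B where "B \<ge> 0" "\<And>t. t0 + 1 \<le> t \<Longrightarrow> norm (x t) \<le> B"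
proof
  \<comment> \<open>Monotonicity holds strictly after \<open>t0\<close>; \<open>t0 + 1\<close> is an
    arbitrary starting time there.\<close>
  let ?M = "lyap (t0 + 1) / (lam * c / 2)"
  show "sqrt ?M \<ge> 0" using c_pos lam_gt_2 lyap_nonneg by simp
  fix t assume t: "t0 + 1 \<le> t"
  have "lam * c / 2 * (norm (x t))\<^sup>2 \<le> lyap (t0 + 1)"
    using lyap_ge[of t] lyap_antimono[of "t0 + 1" t] t by simp
  then have "(norm (x t))\<^sup>2 \<le> ?M"
    using c_pos lam_gt_2 by (subst pos_le_divide_eq) (auto simp: algebra_simps)
  then show "norm (x t) \<le> sqrt ?M" by (rule real_le_rsqrt)
qed

section \<open>Mechanical energy and its decay faster than the inverse square of time\<close>

lemma energy_deriv:
  assumes t: "t0 < t"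
  shows "(energy has_real_derivative - \<alpha> / t * (norm (x' t))\<^sup>2) (at t)"
proof -
  have "(energy has_real_derivative inner (x' t) (x'' t) + inner (x' t) (grad\<Phi> (x t))) (at t)"
    unfolding energy_def[abs_def]
    by (rule derivative_eq_intros gap_deriv[OF t]
        has_real_derivative_norm_power2[OF x'_deriv[OF t]] refl | simp)+
  \<comment> \<open>Pairing the equation with the velocity leaves only the friction term.\<close>
  moreover have "inner (x' t) (x'' t + (\<alpha> / t) *\<^sub>R x' t + grad\<Phi> (x t)) = 0"
    by (simp add: ode[OF t])
  then have "inner (x' t) (x'' t) + inner (x' t) (grad\<Phi> (x t)) = - \<alpha> / t * (norm (x' t))\<^sup>2"
    by (simp add: inner_add_right power2_norm_eq_inner)
  ultimately show ?thesis by simp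
qed

lemma energy_antimono:
  assumes "t0 < a" "a \<le> b"
  shows "energy b \<le> energy a"
proof (rule nonincreasing_of_deriv[OF energy_deriv _ assms])
  fix t assume "t0 < t"
  then show "- \<alpha> / t * (norm (x' t))\<^sup>2 \<le> 0" using t0 alpha by simp
qed

text \<open>The only positive contribution to the derivative of \<open>t\<^sup>2 * energy t\<close>
  is \<open>2 * t * gap t\<close>, up to a nonpositive velocity term; the dissipation of
  \<open>2 / c * lyap\<close> absorbs it.\<close>

lemma scaled_energy_antimono:
  assumes "t0 < a" "a \<le> b"
  shows "b\<^sup>2 * energy b + 2 / c * lyap b \<le> a\<^sup>2 * energy a + 2 / c * lyap a"
proof (rule nonincreasing_of_deriv[where f = "\<lambda>t. t\<^sup>2 * energy t + 2 / c * lyap t", OF _ _ assms])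
  fix t assume t: "t0 < t"
  show "((\<lambda>t. t\<^sup>2 * energy t + 2 / c * lyap t) has_real_derivative
      2 * t * energy t - \<alpha> * t * (norm (x' t))\<^sup>2 + 2 / c * lyap' t) (at t)"
    using t t0
    by (intro DERIV_cong[OF DERIV_add[OF DERIV_mult[OF DERIV_power[OF DERIV_ident] energy_deriv[OF t]]
        DERIV_cmult[OF lyap_deriv[OF t]]]]) (simp add: power2_eq_square)
  have "2 / c * lyap' t \<le> 2 / c * (- c * t * (gap t + (norm (x' t))\<^sup>2))"
    using c_pos by (intro mult_left_mono lyap'_le t) auto
  also have "\<dots> = - 2 * t * (gap t + (norm (x' t))\<^sup>2)" using c_pos by simp
  finally have "2 / c * lyap' t \<le> - 2 * t * (gap t + (norm (x' t))\<^sup>2)" .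
  moreover have "0 \<le> (1 + \<alpha>) * t * (norm (x' t))\<^sup>2" using t t0 alpha by simp
  ultimately show "2 * t * energy t - \<alpha> * t * (norm (x' t))\<^sup>2 + 2 / c * lyap' t \<le> 0"
    by (simp add: energy_def algebra_simps)
qed

text \<open>The limit exists because \<open>lyap\<close> and the monotone sum converge. A positive
  limit would force \<open>lyap\<close> to fall at least logarithmically, contradicting its
  nonnegativity.\<close>

lemma scaled_energy_tendsto_0: "((\<lambda>t. t\<^sup>2 * energy t) \<longlongrightarrow> 0) at_top"
proof -
  obtain E where E: "(lyap \<longlongrightarrow> E) at_top" by (rule lyap_tendsto)
  obtain M where M: "((\<lambda>t. t\<^sup>2 * energy t + 2 / c * lyap t) \<longlongrightarrow> M) at_top"
    by (rule tendsto_at_top_antimono_bdd_below[of t0 "\<lambda>t. t\<^sup>2 * energy t + 2 / c * lyap t" 0])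
       (use scaled_energy_antimono energy_nonneg lyap_nonneg c_pos in auto)
  define L where "L = M - 2 / c * E"
  have L: "((\<lambda>t. t\<^sup>2 * energy t) \<longlongrightarrow> L) at_top"
    using tendsto_diff[OF M tendsto_mult_left[OF E, of "2 / c"]] by (simp add: L_def)
  have "L \<ge> 0"
    by (rule tendsto_lowerbound[OF L]) (auto simp: energy_nonneg)
  moreover have False if "L > 0"
  proof -
    \<comment> \<open>Since \<open>t\<^sup>2 * energy t\<close> eventually exceeds
      \<open>L / 2\<close>, the dissipation is at least \<open>k / t\<close>.\<close>
    define k where "k = c * L / 2"
    have k: "k > 0" using c_pos that by (simp add: k_def)
    from that have "\<forall>\<^sub>F t in at_top. t\<^sup>2 * energy t > L / 2"
      by (intro order_tendstoD(1)[OF L]) simp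
    then obtain T0 where T0: "\<And>t. T0 \<le> t \<Longrightarrow> t\<^sup>2 * energy t > L / 2"
      by (auto simp: eventually_at_top_linorder)
    define T where "T = max T0 (t0 + 1)"
    have T: "t0 < T" "T0 \<le> T" by (auto simp: T_def)
    have "k * ln b \<le> lyap T + k * ln T" if b: "T \<le> b" for b
    proof -
      have "lyap b + k * ln b \<le> lyap T + k * ln T"
      proof (rule nonincreasing_of_deriv[where f = "\<lambda>t. lyap t + k * ln t", OF _ _ T(1) b])
        fix t assume t: "t0 < t" "T \<le> t"
        then show "((\<lambda>t. lyap t + k * ln t) has_real_derivative lyap' t + k / t) (at t)"
          using t0 by (auto intro!: derivative_eq_intros lyap_deriv)
        have tp: "t > 0" using t t0 by simp
        have "k / t \<le> c * (t\<^sup>2 * energy t) / t"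
          using T0[of t] T t c_pos tp by (intro divide_right_mono) (auto simp: k_def)
        also have "\<dots> = c * t * energy t" using tp by (simp add: power2_eq_square)
        also have "\<dots> \<le> c * t * (gap t + (norm (x' t))\<^sup>2)"
          using tp c_pos by (intro mult_left_mono) (auto simp: energy_def)
        finally show "lyap' t + k / t \<le> 0" using lyap'_le[OF t(1)] by simp
      qed
      then show ?thesis using lyap_nonneg[of b] by simp
    qed
    then have "\<forall>\<^sub>F b in at_top. ln b \<le> (lyap T + k * ln T) / k"
      using k by (intro eventually_at_top_linorderI[of T]) (simp add: field_simps)
    moreover have "\<forall>\<^sub>F b in at_top. ln b > (lyap T + k * ln T) / k"
      using ln_at_top by (simp add: filterlim_at_top_dense)
    ultimately have "\<forall>\<^sub>F b :: real in at_top. False" by eventually_elim simp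
    then show False by simp
  qed
  ultimately have "L = 0" by fastforce
  with L show ?thesis by simp
qed

lemma scaled_velocity_tendsto_0: "((\<lambda>t. norm (t *\<^sub>R x' t)) \<longlongrightarrow> 0) at_top"
proof -
  have "((\<lambda>t. sqrt (2 * (t\<^sup>2 * energy t))) \<longlongrightarrow> sqrt (2 * 0)) at_top"
    by (intro tendsto_intros scaled_energy_tendsto_0)
  then have lim: "((\<lambda>t. sqrt (2 * (t\<^sup>2 * energy t))) \<longlongrightarrow> 0) at_top" by simp
  have bound: "norm (norm (t *\<^sub>R x' t)) \<le> sqrt (2 * (t\<^sup>2 * energy t))" for t
  proof -
    have "t\<^sup>2 * (norm (x' t))\<^sup>2 \<le> t\<^sup>2 * (2 * energy t)"
      using gap_nonneg[of t] by (intro mult_left_mono) (auto simp: energy_def)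
    then show ?thesis by (intro real_le_rsqrt) (simp add: power_mult_distrib)
  qed
  show ?thesis
    by (rule Lim_null_comparison[OF always_eventually lim]) (use bound in blast)
qed

lemma gap_tendsto_0: "(gap \<longlongrightarrow> 0) at_top"
proof (rule Lim_null_comparison[OF _ scaled_energy_tendsto_0])
  show "\<forall>\<^sub>F t in at_top. norm (gap t) \<le> t\<^sup>2 * energy t"
  proof (rule eventually_at_top_linorderI[of 1])
    fix t :: real assume "1 \<le> t"
    then have "1 * energy t \<le> t\<^sup>2 * energy t"
      by (intro mult_right_mono energy_nonneg) simp
    moreover have "gap t \<le> energy t" by (simp add: energy_def)
    ultimately show "norm (gap t) \<le> t\<^sup>2 * energy t" using gap_nonneg[of t] by simp
  qed
qed

section \<open>Damped differential inequalities and convergence of the norm\<close>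

lemma damped_inequality_antimono:
  assumes g: "\<And>t. t0 < t \<Longrightarrow> (g has_real_derivative g' t) (at t)"
    and g': "\<And>t. t0 < t \<Longrightarrow> (g' has_real_derivative g'' t) (at t)"
    and le: "\<And>t. \<lbrakk>t0 < t; t \<le> b\<rbrakk> \<Longrightarrow> t * g'' t + \<alpha> * g' t \<le> K * t * (norm (x' t))\<^sup>2"
    and K: "K \<ge> 0" and ab: "t0 < a" "a \<le> b"
  shows "b * g' b + (\<alpha> - 1) * g b + K / c * lyap b \<le> a * g' a + (\<alpha> - 1) * g a + K / c * lyap a"
proof (rule nonincreasing_of_deriv
    [where f = "\<lambda>t. t * g' t + (\<alpha> - 1) * g t + K / c * lyap t", OF _ _ ab])
  fix t assume t: "t0 < t" "t \<le> b"
  \<comment> \<open>The expression \<open>t * g'' t + \<alpha> * g' t\<close> is the exact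
    derivative of \<open>t * g' t + (\<alpha> - 1) * g t\<close>; the dissipation of
    \<open>K / c * lyap\<close> compensates its upper bound.\<close>
  show "((\<lambda>t. t * g' t + (\<alpha> - 1) * g t + K / c * lyap t) has_real_derivative
      t * g'' t + \<alpha> * g' t + K / c * lyap' t) (at t)"
    by (rule DERIV_cong[OF DERIV_add[OF DERIV_add[OF DERIV_mult[OF DERIV_ident g'[OF t(1)]]
        DERIV_cmult[OF g[OF t(1)]]] DERIV_cmult[OF lyap_deriv[OF t(1)]]]])
       (simp add: algebra_simps)
  have "K / c * lyap' t \<le> K / c * (- c * t * (gap t + (norm (x' t))\<^sup>2))"
    using c_pos K by (intro mult_left_mono lyap'_le t) auto
  also have "\<dots> = - K * t * (gap t + (norm (x' t))\<^sup>2)" using c_pos by simp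
  also have "\<dots> \<le> - K * t * (norm (x' t))\<^sup>2"
    using K t t0 gap_nonneg[of t] by (simp add: algebra_simps)
  finally show "t * g'' t + \<alpha> * g' t + K / c * lyap' t \<le> 0" using le[OF t] by simp
qed

lemma norm_power2_tendsto: obtains l where "((\<lambda>t. (norm (x t))\<^sup>2) \<longlongrightarrow> l) at_top"
proof -
  obtain B where B: "B \<ge> 0" "\<And>t. t0 + 1 \<le> t \<Longrightarrow> norm (x t) \<le> B"
    using x_bounded by metis
  obtain E where E: "(lyap \<longlongrightarrow> E) at_top" by (rule lyap_tendsto)
  \<comment> \<open>This is \<open>t * g' t + (\<alpha> - 1) * g t\<close> for \<open>g\<close> the
    squared norm. As \<open>t * g' t\<close> vanishes in the limit and \<open>lyap\<close>
    converges, a limit of the monotone sum yields one for \<open>g\<close>.\<close>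
  define m where "m = (\<lambda>t. t * (2 * inner (x t) (x' t)) + (\<alpha> - 1) * (norm (x t))\<^sup>2)"
  have inner_bound: "norm (t * inner (x t) (x' t)) \<le> B * norm (t *\<^sub>R x' t)" if "t0 + 1 \<le> t" for t
  proof -
    have "norm (inner (x t) (t *\<^sub>R x' t)) \<le> norm (x t) * norm (t *\<^sub>R x' t)"
      by (rule Cauchy_Schwarz_ineq2[folded real_norm_def])
    also have "\<dots> \<le> B * norm (t *\<^sub>R x' t)" by (intro mult_right_mono B that) auto
    finally show ?thesis by simp
  qed
  have lim_inner: "((\<lambda>t. t * inner (x t) (x' t)) \<longlongrightarrow> 0) at_top"
    by (rule Lim_null_comparison[OF eventually_at_top_linorderI[OF inner_bound]
          tendsto_mult_right_zero[OF scaled_velocity_tendsto_0]])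
  have anti: "m b + 2 / c * lyap b \<le> m a + 2 / c * lyap a" if ab: "t0 < a" "a \<le> b" for a b
    unfolding m_def
  proof (rule damped_inequality_antimono[OF _ _ _ _ ab])
    fix t assume t: "t0 < t"
    show "((\<lambda>t. (norm (x t))\<^sup>2) has_real_derivative 2 * inner (x t) (x' t)) (at t)"
      by (rule has_real_derivative_norm_power2[OF x_deriv[OF t]])
    show "((\<lambda>t. 2 * inner (x t) (x' t)) has_real_derivative
        2 * (inner (x' t) (x' t) + inner (x t) (x'' t))) (at t)"
      by (rule DERIV_cmult has_real_derivative_inner x_deriv x'_deriv t)+
    have "t * inner (x t) (x'' t) = inner (x t) (t *\<^sub>R x'' t)" by simp
    also have "\<dots> = - \<alpha> * inner (x t) (x' t) - t * inner (x t) (grad\<Phi> (x t))"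
      unfolding scaled_ode[OF t] by (simp add: inner_diff_right)
    also have "\<dots> \<le> - \<alpha> * inner (x t) (x' t)"
      using t t0 gap_nonneg[of t] gap_le_inner[of t] by simp
    finally show "t * (2 * (inner (x' t) (x' t) + inner (x t) (x'' t))) + \<alpha> * (2 * inner (x t) (x' t))
        \<le> 2 * t * (norm (x' t))\<^sup>2"
      by (simp add: power2_norm_eq_inner algebra_simps)
  qed auto
  have "\<forall>\<^sub>F t in at_top. t * inner (x t) (x' t) > - 1"
    by (rule order_tendstoD(1)[OF lim_inner]) simp
  then obtain T0 where T0: "\<And>t. T0 \<le> t \<Longrightarrow> t * inner (x t) (x' t) > - 1"
    by (auto simp: eventually_at_top_linorder)
  obtain M where M: "((\<lambda>t. m t + 2 / c * lyap t) \<longlongrightarrow> M) at_top"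
  \<comment> \<open>After \<open>T0\<close> the first term of \<open>m\<close> exceeds
    \<open>- 2\<close>, and the other terms are nonnegative.\<close>
  proof (rule tendsto_at_top_antimono_bdd_below[of "max T0 t0" "\<lambda>t. m t + 2 / c * lyap t" "- 2"])
    fix t assume "max T0 t0 < t"
    moreover have "0 \<le> (\<alpha> - 1) * (norm (x t))\<^sup>2" "0 \<le> 2 / c * lyap t"
      using alpha c_pos lyap_nonneg by auto
    ultimately show "- 2 \<le> m t + 2 / c * lyap t"
      using T0[of t] by (simp add: m_def)
  qed (use anti in auto)
  have "((\<lambda>t. ((m t + 2 / c * lyap t) - 2 / c * lyap t - 2 * (t * inner (x t) (x' t))) / (\<alpha> - 1))
      \<longlongrightarrow> (M - 2 / c * E - 2 * 0) / (\<alpha> - 1)) at_top"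
    using alpha by (intro tendsto_intros M E lim_inner) auto
  then have "((\<lambda>t. (norm (x t))\<^sup>2) \<longlongrightarrow> (M - 2 / c * E) / (\<alpha> - 1)) at_top"
    using alpha by (simp add: m_def)
  then show thesis by (rule that)
qed

section \<open>Distance estimate by reflection, and the Cauchy property\<close>

lemma dist_bound:
  assumes B: "norm (x t) \<le> B" "norm (x s) \<le> B" and ts: "t0 < t" "t \<le> s"
  shows "(norm (x t - x s))\<^sup>2 / 2 \<le> (norm (x t))\<^sup>2 - (norm (x s))\<^sup>2
    + (2 * B * (norm (t *\<^sub>R x' t) + norm (s *\<^sub>R x' s)) + 3 / 2 / c * (lyap t - lyap s)) / (\<alpha> - 1)"
proof -
  \<comment> \<open>Up to a constant, \<open>q u\<close> is half the squared distance from
    \<open>x u\<close> to the mirror point \<open>- x s\<close>; \<open>q_eq\<close> rewrites it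
    through the distance to \<open>x s\<close>, so that \<open>q s = 0\<close>.\<close>
  define q where "q = (\<lambda>u. (norm (x u))\<^sup>2 / 2 - 3 / 2 * (norm (x s))\<^sup>2 + inner (x u) (x s))"
  define q' where "q' = (\<lambda>u. inner (x' u) (x u + x s))"
  have q_eq: "q u = (norm (x u))\<^sup>2 - (norm (x s))\<^sup>2 - (norm (x u - x s))\<^sup>2 / 2" for u
    by (simp add: q_def power2_norm_eq_inner inner_diff_left inner_diff_right inner_commute field_simps)
  have "s * q' s + (\<alpha> - 1) * q s + 3 / 2 / c * lyap s \<le> t * q' t + (\<alpha> - 1) * q t + 3 / 2 / c * lyap t"
  proof (rule damped_inequality_antimono[OF _ _ _ _ ts])
    fix u assume u: "t0 < u"
    have cst: "((\<lambda>u. x s) has_vector_derivative 0) (at u)" by simp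
    show "(q has_real_derivative q' u) (at u)"
      unfolding q_def
      by (rule DERIV_cong[OF DERIV_add[OF DERIV_diff[OF
            DERIV_cdivide[OF has_real_derivative_norm_power2[OF x_deriv[OF u]]] DERIV_const]
            has_real_derivative_inner[OF x_deriv[OF u] cst]]])
         (simp add: q'_def inner_add_right inner_commute)
    have xs: "((\<lambda>u. x u + x s) has_vector_derivative x' u) (at u)"
      using has_vector_derivative_add[OF x_deriv[OF u] cst] by simp
    show "(q' has_real_derivative inner (x'' u) (x u + x s) + inner (x' u) (x' u)) (at u)"
      unfolding q'_def by (rule has_real_derivative_inner[OF x'_deriv[OF u] xs])
    assume us: "u \<le> s"
    \<comment> \<open>Tangent inequality at \<open>x u\<close>, evaluated at the mirror point, where
      evenness gives the value \<open>\<Phi> (x s)\<close>.\<close>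
    have "\<Phi> (x u) + inner (grad\<Phi> (x u)) (- x s - x u) \<le> \<Phi> (- x s)"
      by (rule convex_gderiv_le[OF conv grad])
    then have "- inner (grad\<Phi> (x u)) (x u + x s) \<le> gap s - gap u"
      by (simp add: even gap_def inner_diff_right inner_add_right)
    \<comment> \<open>Energy decreases from \<open>u\<close> to \<open>s\<close>, hence the
      restriction \<open>u \<le> s\<close>. This half and the full
      \<open>inner (x' u) (x' u)\<close> from the second derivative of \<open>q\<close> make up
      \<open>K = 3 / 2\<close>.\<close>
    also have "\<dots> \<le> (norm (x' u))\<^sup>2 / 2"
      using energy_antimono[OF u us] zero_le_power2[of "norm (x' s)"]
      unfolding energy_def by linarith
    finally have "u * (- inner (grad\<Phi> (x u)) (x u + x s)) \<le> u * ((norm (x' u))\<^sup>2 / 2)"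
      using u t0 by (intro mult_left_mono) auto
    moreover have "u * inner (x'' u) (x u + x s) = inner (u *\<^sub>R x'' u) (x u + x s)" by simp
    then have "u * inner (x'' u) (x u + x s) =
        - \<alpha> * q' u - u * inner (grad\<Phi> (x u)) (x u + x s)"
      unfolding scaled_ode[OF u] by (simp add: q'_def inner_diff_left)
    ultimately show "u * (inner (x'' u) (x u + x s) + inner (x' u) (x' u)) + \<alpha> * q' u
        \<le> 3 / 2 * u * (norm (x' u))\<^sup>2"
      by (simp add: power2_norm_eq_inner distrib_left)
  qed auto
  moreover have "q s = 0" by (simp add: q_eq)
  moreover have q'_bound: "\<bar>u * q' u\<bar> \<le> 2 * B * norm (u *\<^sub>R x' u)" if "norm (x u) \<le> B" for u
  proof -
    have "\<bar>inner (u *\<^sub>R x' u) (x u + x s)\<bar> \<le> norm (u *\<^sub>R x' u) * norm (x u + x s)"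
      by (rule Cauchy_Schwarz_ineq2)
    also have "\<dots> \<le> norm (u *\<^sub>R x' u) * (2 * B)"
      using norm_triangle_ineq[of "x u" "x s"] that B(2) by (intro mult_left_mono) auto
    finally show ?thesis by (simp add: q'_def mult.commute)
  qed
  ultimately have "- q t * (\<alpha> - 1) \<le>
      2 * B * (norm (t *\<^sub>R x' t) + norm (s *\<^sub>R x' s)) + 3 / 2 / c * (lyap t - lyap s)"
    using q'_bound[OF B(1)] q'_bound[OF B(2)]
    by (simp add: algebra_simps)
  then have "- q t \<le>
      (2 * B * (norm (t *\<^sub>R x' t) + norm (s *\<^sub>R x' s)) + 3 / 2 / c * (lyap t - lyap s)) / (\<alpha> - 1)"
    using alpha by (subst pos_le_divide_eq) auto
  then show ?thesis by (simp only: q_eq)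
qed

lemma x_tendsto: obtains z where "(x \<longlongrightarrow> z) at_top"
proof -
  obtain B where B: "B \<ge> 0" "\<And>t. t0 + 1 \<le> t \<Longrightarrow> norm (x t) \<le> B"
    using x_bounded by metis
  obtain E where E: "(lyap \<longlongrightarrow> E) at_top" by (rule lyap_tendsto)
  obtain l where l: "((\<lambda>t. (norm (x t))\<^sup>2) \<longlongrightarrow> l) at_top" by (rule norm_power2_tendsto)
  \<comment> \<open>The bound of \<open>dist_bound\<close> becomes
    \<open>p t - p s + r t + r s\<close>, with \<open>p\<close> convergent and \<open>r\<close>
    tending to 0.\<close>
  define p where "p = (\<lambda>t. (norm (x t))\<^sup>2 + 3 / 2 / c * lyap t / (\<alpha> - 1))"
  define r where "r = (\<lambda>t. 2 * B * norm (t *\<^sub>R x' t) / (\<alpha> - 1))"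
  define P where "P = l + 3 / 2 / c * E / (\<alpha> - 1)"
  have p: "(p \<longlongrightarrow> P) at_top"
    unfolding p_def P_def using alpha by (intro tendsto_intros E l) auto
  have r: "(r \<longlongrightarrow> 0) at_top"
    unfolding r_def by (intro tendsto_divide_zero tendsto_mult_right_zero scaled_velocity_tendsto_0)
  have bound: "(dist (x t) (x s))\<^sup>2 / 2 \<le> \<bar>p t - p s\<bar> + \<bar>r t\<bar> + \<bar>r s\<bar>"
    if "t0 + 1 \<le> t" "t0 + 1 \<le> s" for t s
  proof -
    have *: "(dist (x t) (x s))\<^sup>2 / 2 \<le> p t - p s + r t + r s" if "t0 + 1 \<le> t" "t \<le> s" for t s
    proof -
      have "p t - p s + r t + r s = (norm (x t))\<^sup>2 - (norm (x s))\<^sup>2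
          + (2 * B * (norm (t *\<^sub>R x' t) + norm (s *\<^sub>R x' s)) + 3 / 2 / c * (lyap t - lyap s)) / (\<alpha> - 1)"
        unfolding p_def r_def distrib_left right_diff_distrib add_divide_distrib diff_divide_distrib
        by linarith
      with dist_bound[of t B s] B(2)[of t] B(2)[of s] that show ?thesis
        by (simp only: dist_norm)
    qed
    show ?thesis
    proof (cases "t \<le> s")
      case True
      with *[of t s] that show ?thesis by linarith
    next
      case False
      with *[of s t] that show ?thesis unfolding dist_commute[of "x s"] by linarith
    qed
  qed
  have "cauchy_filter (filtermap x at_top)"
    unfolding cauchy_filter_metric_filtermap
  proof (intro allI impI)
    fix e :: real assume "e > 0"
    \<comment> \<open>The difference of \<open>p\<close> costs at most \<open>2 * d\<close> and each
      \<open>r\<close> at most \<open>d\<close>, so half the squared distance stays below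
      \<open>4 * d\<close>, which is \<open>e\<^sup>2 / 2\<close>.\<close>
    define d where "d = e\<^sup>2 / 8"
    have d: "d > 0" using \<open>e > 0\<close> by (simp add: d_def)
    let ?Q = "\<lambda>t. t0 + 1 \<le> t \<and> dist (p t) P < d \<and> dist (r t) 0 < d"
    have ev: "eventually ?Q at_top"
      using d by (intro eventually_conj eventually_ge_at_top tendstoD[OF p] tendstoD[OF r])
    have "dist (x t) (x s) < e" if "?Q t" "?Q s" for t s
    proof -
      have "(dist (x t) (x s))\<^sup>2 / 2 < 4 * d"
        using bound[of t s] that unfolding dist_real_def diff_0_right by linarith
      then have "(dist (x t) (x s))\<^sup>2 < e\<^sup>2" by (simp add: d_def)
      then show ?thesis by (rule power2_less_imp_less) (use \<open>e > 0\<close> in simp)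
    qed
    with ev show "\<exists>Q. eventually Q at_top \<and> (\<forall>t s. Q t \<and> Q s \<longrightarrow> dist (x t) (x s) < e)"
      by (intro exI[of _ ?Q]) simp
  qed
  then have "\<exists>z. filtermap x at_top \<le> nhds z"
    by (rule cauchy_filter_complete_converges[OF _ complete_UNIV]) (simp_all add: filtermap_bot_iff)
  then obtain z where "filtermap x at_top \<le> nhds z" by blast
  then have "(x \<longlongrightarrow> z) at_top" by (simp add: filterlim_def)
  then show thesis by (rule that)
qed

end

section \<open>Strong convergence and identification of the limit as a minimizer\<close>

theorem theorem3p2:
  fixes \<Phi> :: "'a::{real_inner, complete_space} \<Rightarrow> real"
    and grad\<Phi> :: "'a \<Rightarrow> 'a"
    and \<alpha> t0 :: real
    and x :: "real \<Rightarrow> 'a"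
  assumes grad: "\<And>u. GDERIV \<Phi> u :> grad\<Phi> u"
    and grad_cont: "continuous_on UNIV grad\<Phi>"
    and conv: "convex_on UNIV \<Phi>"
    and even: "\<And>u. \<Phi> (- u) = \<Phi> u"
    and t0: "t0 > 0"
    and alpha: "\<alpha> > 3"
    and sol: "solution_on \<alpha> grad\<Phi> t0 x"
  shows "\<exists>z\<in>argmin \<Phi>. (x \<longlongrightarrow> z) at_top"
proof -
  obtain x' x'' where
    d1: "\<And>t. t \<ge> t0 \<Longrightarrow> (x has_vector_derivative x' t) (at t within {t0..})" and
    d2: "\<And>t. t \<ge> t0 \<Longrightarrow> (x' has_vector_derivative x'' t) (at t within {t0..})" and
    ode: "\<And>t. t \<ge> t0 \<Longrightarrow> x'' t + (\<alpha> / t) *\<^sub>R x' t + grad\<Phi> (x t) = 0"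
    using sol unfolding solution_on_def by metis
  \<comment> \<open>At interior times the one-sided derivatives of the solution are two-sided, as
    the locale requires.\<close>
  have at: "at t within {t0..} = at t" if "t0 < t" for t
    using that by (intro at_within_interior) simp
  interpret damped_even_flow \<Phi> grad\<Phi> \<alpha> t0 x x' x''
  proof
    fix t assume t: "t0 < t"
    show "(x has_vector_derivative x' t) (at t)" using d1[of t] t by (simp add: at)
    show "(x' has_vector_derivative x'' t) (at t)" using d2[of t] t by (simp add: at)
    show "x'' t + (\<alpha> / t) *\<^sub>R x' t + grad\<Phi> (x t) = 0" using ode[of t] t by simp
  qed (fact grad conv even t0 alpha)+
  obtain z where z: "(x \<longlongrightarrow> z) at_top" by (rule x_tendsto)
  \<comment> \<open>The limit of \<open>\<Phi>\<close> along the trajectory is found twice: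
    \<open>\<Phi> z\<close> by continuity, and the minimum \<open>\<Phi> 0\<close> because the gap
    vanishes.\<close>
  have "isCont \<Phi> z"
    using grad[of z] by (auto simp: gderiv_def intro: has_derivative_continuous)
  from isCont_tendsto_compose[OF this z] have "((\<lambda>t. \<Phi> (x t)) \<longlongrightarrow> \<Phi> z) at_top" .
  moreover have "((\<lambda>t. \<Phi> (x t)) \<longlongrightarrow> \<Phi> 0) at_top"
    using tendsto_add[OF gap_tendsto_0 tendsto_const[of "\<Phi> 0"]] by (simp add: gap_def[abs_def])
  ultimately have "\<Phi> z = \<Phi> 0"
    using tendsto_unique trivial_limit_at_top_linorder by blast
  then have "z \<in> argmin \<Phi>"
    using zero_min by (simp add: argmin_def is_arg_min_linorder)
  with z show ?thesis by blast
qed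

end
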